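(* Let $G=\gamma_1\times\gamma_2\times\cdots\times\gamma_k$ be a torus (each $\gamma_i$ an undirected cycle) that has a Hamiltonian cycle, and let $\gamma_{k+1}$ be an undirected cycle such that $|\gamma_{k+1}|$ is a multiple of $|\gamma_j|$ for some $j\leq k$. Then $\mathrm{mrl}(G\times\gamma_{k+1})\geq\mathrm{mrl}(G)$.
   Context: A torus is a Cartesian product $G=\gamma_1\times\gamma_2\times\cdots\times\gamma_k$ where each $\gamma_i$ is a cycle; it comes with this decomposition, the $\gamma_i$ are called the dimensions of $G$, and every edge of $G$ lies in exactly one dimension (the index $i$ of the coordinate that changes along the edge). A cycle has at least two vertices; a cycle on two vertices is allowed (as a closed walk it traverses back and forth between its two vertices). $|\gamma_i|$ is the number of vertices of $\gamma_i$. $G\times\gamma_{k+1}$ is regarded as the torus with dimensions $\gamma_1,\dots,\gamma_{k+1}$. A Hamiltonian cycle in $G$ is a cycle passing through every vertex exactly once. The run length $\mathrm{rl}(H)$ of a Hamiltonian cycle $H$ in $G$ is the maximum $r$ such that any sequence of $r$ (cyclically) consecutive edges of $H$ contains no more than one edge in any one dimension. The maximum run length $\mathrm{mrl}(G)$ is the maximum of $\mathrm{rl}(H)$ over all Hamiltonian cycles $H$ in $G$. *)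

theory Defs
  imports "Graph_Theory.Pair_Digraph"
begin

(* Undirected graphs are the symmetric digraphs of Graph_Theory, so "pre_digraph.cycle"
   admits the closed walk u, v, u; this is the traversal of a cycle on two vertices.
   A cycle repeats no vertex, hence the equation below says that every vertex is
   visited exactly once. *)
definition hamiltonian_cycle :: "'a pair_pre_digraph \<Rightarrow> ('a \<times> 'a) awalk \<Rightarrow> bool" where
  "hamiltonian_cycle G p \<longleftrightarrow> pre_digraph.cycle (with_proj G) p \<and> fst ` set p = pverts G"

definition hamiltonian :: "'a pair_pre_digraph \<Rightarrow> bool" where
  "hamiltonian G \<longleftrightarrow> (\<exists>p. hamiltonian_cycle G p)"

(* Since "pair_graph" excludes loops, there are at least two vertices. *)
definition undirected_cycle :: "'a pair_pre_digraph \<Rightarrow> bool" where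
  "undirected_cycle C \<longleftrightarrow>
     pair_graph C \<and> (\<exists>p. hamiltonian_cycle C p \<and> parcs C = set p \<union> (set p)\<inverse>)"

(* The Cartesian product of a list of graphs; its vertices are coordinate lists. *)
definition torus :: "'a pair_pre_digraph list \<Rightarrow> 'a list pair_pre_digraph" where
  "torus Cs = (let V = {xs. length xs = length Cs \<and> (\<forall>i<length Cs. xs ! i \<in> pverts (Cs ! i))} in
     \<lparr> pverts = V,
       parcs = {(xs, ys). xs \<in> V \<and> ys \<in> V \<and>
         (\<exists>i<length Cs. (xs ! i, ys ! i) \<in> parcs (Cs ! i) \<and>
           (\<forall>j<length Cs. j \<noteq> i \<longrightarrow> xs ! j = ys ! j))} \<rparr>)"

definition arc_dim :: "'a list \<times> 'a list \<Rightarrow> nat" where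
  "arc_dim e = (THE i. i < length (fst e) \<and> fst e ! i \<noteq> snd e ! i)"

(* Any r cyclically consecutive arcs, starting at any position s, contain at most one
   arc in each dimension d. *)
definition run_property :: "('a list \<times> 'a list) awalk \<Rightarrow> nat \<Rightarrow> bool" where
  "run_property p r \<longleftrightarrow>
     (\<forall>s d. card {i. i < r \<and> arc_dim (p ! ((s + i) mod length p)) = d} \<le> 1)"

(* Both maxima are over finite sets: a run contains at most one arc per dimension, so
   run lengths are at most the number of dimensions. *)
definition run_length :: "('a list \<times> 'a list) awalk \<Rightarrow> nat" where
  "run_length p = Max {r. run_property p r}"

definition max_run_length :: "'a pair_pre_digraph list \<Rightarrow> nat" where
  "max_run_length Cs = Max {run_length p | p. hamiltonian_cycle (torus Cs) p}"

end

(* Let H be a Hamiltonian cycle of the torus and project gamma_j x gamma onto gamma_j by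
   (x, y) |-> x + y, which makes sense since |gamma_j| divides |gamma|.  An arc of H in dimension j
   lifts along this projection to an arc in dimension j as well as to one in the new dimension.
   Some arc of H lies in dimension j; lift one such arc to the new dimension and all other arcs
   to their own dimension.  Every lap around H then changes the new coordinate by one step, so that
   |gamma| laps close up to a single Hamiltonian cycle.  Sending the new dimension to j maps
   its sequence of dimensions to that of H, so distinct dimensions in a run of H stay distinct. *)
theory Submission
  imports Defs
begin

section \<open>Hamiltonian cycles as periodic sequences\<close>

lemma cas_nth:
  assumes "pre_digraph.cas (with_proj G) u p v" "p \<noteq> []"
  shows "fst (p ! 0) = u \<and> snd (p ! (length p - 1)) = v \<and>
    (\<forall>i. Suc i < length p \<longrightarrow> snd (p ! i) = fst (p ! Suc i))"
  using assms
proof (induction p arbitrary: u)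
  case Nil
  then show ?case by simp
next
  case (Cons e es)
  note [simp] = pre_digraph.cas.simps
  show ?case
  proof (cases "es = []")
    case True
    with Cons.prems show ?thesis by auto
  next
    case False
    with Cons.IH[of "snd e"] Cons.prems(1) show ?thesis
      by (auto simp: nth_Cons split: nat.split)
  qed
qed

text \<open>\<open>cycle\<close> asks for distinctness of the tail of \<open>awalk_verts\<close>; by
  this equation it becomes distinctness of the heads of the arcs.\<close>

lemma awalk_verts_eq_map_snd:
  assumes "pre_digraph.cas (with_proj G) u p v"
  shows "pre_digraph.awalk_verts (with_proj G) u p = u # map snd p"
  using assms
  by (induction p arbitrary: u) (auto simp: pre_digraph.cas.simps pre_digraph.awalk_verts.simps)

lemma cas_map_upt:
  assumes "a \<le> b"
  shows "pre_digraph.cas (with_proj G) (f a) (map (\<lambda>i. (f i, f (Suc i))) [a..<b]) (f b)"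
  using assms
  by (induction a rule: inc_induct) (auto simp: pre_digraph.cas.simps upt_conv_Cons)

lemma hamiltonian_cycleI:
  fixes f :: "nat \<Rightarrow> 'a"
  assumes "0 < n" "f n = f 0" "inj_on f {..<n}" "f ` {..<n} = pverts G"
    and arcs: "\<And>i. i < n \<Longrightarrow> (f i, f (Suc i)) \<in> parcs G"
  shows "hamiltonian_cycle G (map (\<lambda>i. (f i, f (Suc i))) [0..<n])" (is "hamiltonian_cycle G ?p")
proof -
  have cas: "pre_digraph.cas (with_proj G) (f 0) ?p (f 0)"
    using cas_map_upt[of 0 n G f] assms(2) by simp
  have "inj_on (\<lambda>i. f (Suc i)) {..<n}"
  proof (rule inj_onI)
    fix x y assume xy: "x \<in> {..<n}" "y \<in> {..<n}" "f (Suc x) = f (Suc y)"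
    \<comment> \<open>Heads are tails one index later. Since injectivity is known only below
      \<open>n\<close>, \<open>r\<close> wraps the index \<open>n\<close> to 0, which
      \<open>f n = f 0\<close> allows.\<close>
    define r where "r z = (if z = n then 0 else z)" for z
    have "f (r (Suc x)) = f (r (Suc y))" "r (Suc x) < n" "r (Suc y) < n"
      using xy assms(1,2) by (auto simp: r_def)
    then have "r (Suc x) = r (Suc y)" using assms(3) by (auto dest: inj_onD)
    then show "x = y" using xy by (auto simp: r_def split: if_splits)
  qed
  then have "distinct (map snd ?p)"
    by (simp add: distinct_map comp_def atLeast0LessThan)
  moreover have "f 0 \<in> pverts G" using assms(1,4) by blast
  moreover have "set ?p \<subseteq> parcs G" using arcs by auto
  ultimately have "pre_digraph.cycle (with_proj G) ?p"
    using assms(1) cas unfolding pre_digraph.cycle_def pre_digraph.awalk_def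
    by (intro exI[of _ "f 0"]) (auto simp: awalk_verts_eq_map_snd[OF cas])
  moreover have "fst ` set ?p = pverts G"
    using assms(4) by (simp add: image_image atLeast0LessThan)
  ultimately show ?thesis by (simp add: hamiltonian_cycle_def)
qed

text \<open>The vertex sequence is extended periodically to all of the naturals, so that closing up
  is no special case and equality of vertices is congruence of indices.\<close>

lemma hamiltonian_cycleE:
  assumes "hamiltonian_cycle G p"
  obtains f where "length p > 0"
    and "\<And>i. p ! (i mod length p) = (f i, f (Suc i))"
    and "\<And>i. (f i, f (Suc i)) \<in> parcs G"
    and "\<And>i k. f i = f k \<longleftrightarrow> i mod length p = k mod length p"
    and "f ` {..<length p} = pverts G"
proof -
  let ?n = "length p"
  define f where "f i = fst (p ! (i mod ?n))" for i
  from assms obtain u where cas: "pre_digraph.cas (with_proj G) u p u" and "p \<noteq> []"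
    and "set p \<subseteq> parcs G" and dist: "distinct (map snd p)" and verts: "fst ` set p = pverts G"
    unfolding hamiltonian_cycle_def pre_digraph.cycle_def pre_digraph.awalk_def
    by (auto simp: awalk_verts_eq_map_snd)
  then have pos: "?n > 0" by simp
  note nth = cas_nth[OF cas \<open>p \<noteq> []\<close>]
  have snd: "snd (p ! (i mod ?n)) = f (Suc i)" for i
  proof (cases "Suc (i mod ?n) = ?n")
    case True
    then have "i mod ?n = ?n - 1" by simp
    with True nth show ?thesis by (simp add: f_def mod_Suc)
  next
    case False
    moreover have "i mod ?n < ?n" using pos by simp
    ultimately have "Suc (i mod ?n) < ?n" by linarith
    with False nth show ?thesis by (simp add: f_def mod_Suc)
  qed
  have p: "p ! (i mod ?n) = (f i, f (Suc i))" for i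
    using snd[of i] by (simp add: f_def prod_eq_iff)
  have arcs: "(f i, f (Suc i)) \<in> parcs G" for i
    using pos \<open>set p \<subseteq> parcs G\<close> nth_mem[of "i mod ?n" p] by (auto simp: p)
  have Suc_eq: "i mod ?n = k mod ?n" if "f (Suc i) = f (Suc k)" for i k
    using that dist pos nth_eq_iff_index_eq[of "map snd p" "i mod ?n" "k mod ?n"] by (simp add: snd)
  have eq: "f i = f k \<longleftrightarrow> i mod ?n = k mod ?n" for i k
  proof
    assume "f i = f k"
    \<comment> \<open>Adding \<open>?n - 1\<close> and then \<open>Suc\<close> goes once around.
      This writes both vertices as heads of arcs, for which \<open>Suc_eq\<close> provides
      distinctness.\<close>
    then have "f (Suc (i + (?n - 1))) = f (Suc (k + (?n - 1)))"
      using pos by (simp add: f_def del: add_Suc_right flip: add_Suc_right)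
    from Suc_eq[OF this] have "Suc (i + (?n - 1)) mod ?n = Suc (k + (?n - 1)) mod ?n"
      by (metis mod_Suc_eq)
    then show "i mod ?n = k mod ?n" using pos by simp
  qed (simp add: f_def)
  have "set p = (!) p ` {..<?n}" by (auto simp: set_conv_nth)
  then have "f ` {..<?n} = fst ` set p"
    unfolding f_def by (simp add: image_image)
  then show ?thesis using that[of f] pos p arcs eq verts by blast
qed

text \<open>Integer indices turn the two directions of travel into steps by 1 and -1 and make
  translation of the cycle available. On two vertices both steps lead to the same vertex.\<close>

lemma undirected_cycleE:
  assumes "undirected_cycle C"
  obtains c :: "int \<Rightarrow> 'a" where "card (pverts C) \<ge> 2"
    and "\<And>a b. c a = c b \<longleftrightarrow> a mod int (card (pverts C)) = b mod int (card (pverts C))"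
    and "range c = pverts C"
    and "\<And>u v. (u, v) \<in> parcs C \<longleftrightarrow> (\<exists>a. \<exists>e\<in>{1, -1}. u = c a \<and> v = c (a + e))"
proof -
  from assms obtain p where G: "pair_graph C" and p: "hamiltonian_cycle C p"
    and arcs: "parcs C = set p \<union> (set p)\<inverse>"
    unfolding undirected_cycle_def by blast
  from p obtain f where pos: "length p > 0"
    and nth: "\<And>i. p ! (i mod length p) = (f i, f (Suc i))"
    and "\<And>i. (f i, f (Suc i)) \<in> parcs C"
    and eq: "\<And>i k. f i = f k \<longleftrightarrow> i mod length p = k mod length p"
    and verts: "f ` {..<length p} = pverts C"
    by (rule hamiltonian_cycleE) blast
  let ?n = "length p"
  interpret pair_graph C by (rule G)
  have "inj_on f {..<?n}" by (rule inj_onI) (simp add: eq)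
  then have n: "card (pverts C) = ?n" using verts by (metis card_image card_lessThan)
  \<comment> \<open>A closed walk of length 1 would be a loop.\<close>
  have "f 0 \<noteq> f (Suc 0)" using pair_no_loops[OF \<open>(f 0, f (Suc 0)) \<in> parcs C\<close>] by simp
  then have "?n \<noteq> 1" by (auto simp: eq)
  with pos have n2: "?n \<ge> 2" by linarith
  define c where "c a = f (nat (a mod int ?n))" for a :: int
  have c: "c a = c b \<longleftrightarrow> a mod int ?n = b mod int ?n" for a b
    using pos by (simp add: c_def eq nat_less_iff eq_nat_nat_iff)
  have c_nat: "c (int i) = f i" for i by (simp add: c_def eq nat_mod_distrib)
  have c_arc: "(c a, c (a + 1)) \<in> set p" for a
  proof -
    let ?i = "nat (a mod int ?n)"
    have "c a = c (int ?i)" "c (a + 1) = c (int (Suc ?i))"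
      using pos by (auto simp: c mod_simps add.commute)
    then have "(c a, c (a + 1)) = p ! (?i mod ?n)" unfolding nth c_nat by simp
    then show ?thesis using pos by simp
  qed
  have set_p: "(u, v) \<in> set p \<longleftrightarrow> (\<exists>a. u = c a \<and> v = c (a + 1))" for u v
  proof
    assume "(u, v) \<in> set p"
    then obtain i where "i < ?n" "p ! i = (u, v)" by (auto simp: in_set_conv_nth)
    then have "u = c (int i)" "v = c (int i + 1)"
      using nth[of i] c_nat[of "Suc i"] by (auto simp: c_nat add.commute)
    then show "\<exists>a. u = c a \<and> v = c (a + 1)" by blast
  qed (use c_arc in blast)
  have "range c = f ` {..<?n}"
  proof
    show "range c \<subseteq> f ` {..<?n}" using pos by (auto simp: c_def nat_less_iff)
    show "f ` {..<?n} \<subseteq> range c" by (auto simp flip: c_nat)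
  qed
  moreover have "(u, v) \<in> parcs C \<longleftrightarrow> (\<exists>a. \<exists>e\<in>{1, -1}. u = c a \<and> v = c (a + e))" for u v
  proof -
    have "(\<exists>a. v = c a \<and> u = c (a + 1)) \<longleftrightarrow> (\<exists>a. u = c a \<and> v = c (a + - 1))"
      by (metis add.commute add_minus_cancel minus_add_cancel)
    then show ?thesis by (auto simp: arcs set_p)
  qed
  ultimately show ?thesis using n2 c verts by (intro that[of c]) (simp_all only: n)
qed

section \<open>Tori\<close>

lemma in_pverts_torus:
  "xs \<in> pverts (torus Cs) \<longleftrightarrow>
     length xs = length Cs \<and> (\<forall>i<length Cs. xs ! i \<in> pverts (Cs ! i))"
  by (simp add: torus_def Let_def)

lemma in_parcs_torus:
  "(xs, ys) \<in> parcs (torus Cs) \<longleftrightarrow> xs \<in> pverts (torus Cs) \<and> ys \<in> pverts (torus Cs) \<and>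
     (\<exists>i<length Cs. (xs ! i, ys ! i) \<in> parcs (Cs ! i) \<and>
        (\<forall>j<length Cs. j \<noteq> i \<longrightarrow> xs ! j = ys ! j))"
  by (simp add: torus_def Let_def)

lemma snoc_in_pverts_torus:
  "xs @ [x] \<in> pverts (torus (Cs @ [C])) \<longleftrightarrow> xs \<in> pverts (torus Cs) \<and> x \<in> pverts C"
  by (auto simp: in_pverts_torus nth_append less_Suc_eq)

lemma snoc_in_parcs_torus:
  assumes "(xs, ys) \<in> parcs (torus Cs)" "x \<in> pverts C"
  shows "(xs @ [x], ys @ [x]) \<in> parcs (torus (Cs @ [C]))"
proof -
  from assms obtain i where "i < length Cs" "(xs ! i, ys ! i) \<in> parcs (Cs ! i)"
    "\<forall>j<length Cs. j \<noteq> i \<longrightarrow> xs ! j = ys ! j" "length xs = length Cs" "length ys = length Cs"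
    by (auto simp: in_parcs_torus in_pverts_torus)
  moreover have "xs @ [x] \<in> pverts (torus (Cs @ [C]))" "ys @ [x] \<in> pverts (torus (Cs @ [C]))"
    using assms by (auto simp: snoc_in_pverts_torus in_parcs_torus)
  ultimately show ?thesis
    unfolding in_parcs_torus by (auto simp: nth_append intro!: exI[of _ i])
qed

lemma snoc_in_parcs_torus_last:
  assumes "xs \<in> pverts (torus Cs)" "(x, y) \<in> parcs C" "x \<in> pverts C" "y \<in> pverts C"
  shows "(xs @ [x], xs @ [y]) \<in> parcs (torus (Cs @ [C]))"
  using assms unfolding in_parcs_torus
  by (auto simp: snoc_in_pverts_torus in_pverts_torus nth_append intro!: exI[of _ "length Cs"])

lemma arc_dim_eq:
  assumes "i < length xs" "xs ! i \<noteq> ys ! i" "\<And>k. k < length xs \<Longrightarrow> k \<noteq> i \<Longrightarrow> xs ! k = ys ! k"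
  shows "arc_dim (xs, ys) = i"
  unfolding arc_dim_def using assms by (intro the_equality) auto

section \<open>Run lengths\<close>

text \<open>Fibres of size at most one mean injectivity, a form in which the run property can be
  pulled back along a map between dimensions.\<close>

lemma run_property_iff_inj_on:
  "run_property p r \<longleftrightarrow> (\<forall>s. inj_on (\<lambda>i. arc_dim (p ! ((s + i) mod length p))) {..<r})"
proof -
  have "(\<forall>d. card {i. i < r \<and> g i = d} \<le> 1) \<longleftrightarrow> inj_on g {..<r}" for g :: "nat \<Rightarrow> nat"
    by (auto simp: card_le_Suc0_iff_eq inj_on_def)
  then show ?thesis by (simp add: run_property_def)
qed

text \<open>A window longer than the walk meets the same arc at offsets 0 and
  \<open>length p\<close>. The bound makes the set under \<open>Max\<close> in
  \<open>run_length\<close> finite.\<close>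

lemma run_property_le_length:
  assumes "run_property p r" "p \<noteq> []"
  shows "r \<le> length p"
proof (rule ccontr)
  assume "\<not> r \<le> length p"
  with assms have "inj_on (\<lambda>i. arc_dim (p ! (i mod length p))) {..<r}" "length p < r"
    by (auto simp: run_property_iff_inj_on dest: spec[of _ 0])
  from inj_onD[OF this(1), of 0 "length p"] this(2) assms(2) show False by auto
qed

lemma finite_run_property: "p \<noteq> [] \<Longrightarrow> finite {r. run_property p r}"
  using run_property_le_length by (blast intro: finite_subset[of _ "{..length p}"])

lemma run_property_run_length: "p \<noteq> [] \<Longrightarrow> run_property p (run_length p)"
proof -
  \<comment> \<open>\<open>Max\<close> is an element of the set only if the set is nonempty.\<close>
  have "run_property p 0" by (simp add: run_property_iff_inj_on)
  then show "p \<noteq> [] \<Longrightarrow> ?thesis"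
    using Max_in[OF finite_run_property, of p] by (auto simp: run_length_def)
qed

lemma run_length_ge: "p \<noteq> [] \<Longrightarrow> run_property p r \<Longrightarrow> r \<le> run_length p"
  unfolding run_length_def by (rule Max_ge) (auto intro: finite_run_property)

lemma hamiltonian_cycle_not_Nil: "hamiltonian_cycle G p \<Longrightarrow> p \<noteq> []"
  by (auto simp: hamiltonian_cycle_def pre_digraph.cycle_def)

lemma length_hamiltonian_cycle: "hamiltonian_cycle G p \<Longrightarrow> length p = card (pverts G)"
proof (erule hamiltonian_cycleE)
  fix f assume eq: "\<And>i k. f i = f k \<longleftrightarrow> i mod length p = k mod length p"
    and "f ` {..<length p} = pverts G"
  moreover have "inj_on f {..<length p}" by (rule inj_onI) (simp add: eq)
  ultimately show "length p = card (pverts G)" by (metis card_image card_lessThan)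
qed

text \<open>A run length is at most the length of its cycle, and all Hamiltonian cycles of a graph
  have the same length.\<close>

lemma finite_run_lengths: "finite {run_length p | p. hamiltonian_cycle (torus Cs) p}"
proof (rule finite_subset)
  show "{run_length p | p. hamiltonian_cycle (torus Cs) p} \<subseteq> {..card (pverts (torus Cs))}"
  proof (intro subsetI, unfold mem_Collect_eq atMost_iff, elim exE conjE, hypsubst)
    fix p assume p: "hamiltonian_cycle (torus Cs) p"
    note p_ne = hamiltonian_cycle_not_Nil[OF p]
    show "run_length p \<le> card (pverts (torus Cs))"
      using run_property_le_length[OF run_property_run_length[OF p_ne] p_ne]
        length_hamiltonian_cycle[OF p] by simp
  qed
qed simp

section \<open>Lifting a Hamiltonian cycle\<close>

text \<open>\<open>Cs ! j\<close> has at least two vertices, so changing coordinate \<open>j\<close>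
  of one vertex of the torus gives another vertex, and \<open>f\<close> reaches both.\<close>

lemma hamiltonian_cycle_uses_dim:
  assumes "undirected_cycle (Cs ! j)" "j < length Cs" "f ` A = pverts (torus Cs)"
    and "pverts (torus Cs) \<noteq> {}"
  obtains a b where "a \<in> A" "b \<in> A" "f a ! j \<noteq> f b ! j"
proof -
  from assms(4) obtain xs where xs: "xs \<in> pverts (torus Cs)" by blast
  from assms(1) have "card (pverts (Cs ! j)) \<ge> 2" by (rule undirected_cycleE)
  then obtain x where "x \<in> pverts (Cs ! j)" "x \<noteq> xs ! j"
    by (metis card_le_Suc0_iff_eq card.infinite not_less_eq_eq numeral_2_eq_2 zero_le)
  then have "xs[j := x] \<in> pverts (torus Cs)" "xs[j := x] ! j \<noteq> xs ! j"
    using xs assms(2) by (auto simp: in_pverts_torus nth_list_update)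
  with xs show ?thesis using that assms(3) by (metis imageE)
qed

lemma lift_hamiltonian_cycle:
  assumes H: "hamiltonian_cycle (torus Cs) p" and j: "j < length Cs"
    and Cj: "undirected_cycle (Cs ! j)" and C: "undirected_cycle C"
    and loopfree: "\<And>i. i < length Cs \<Longrightarrow> pair_graph (Cs ! i)"
    and dvd: "card (pverts (Cs ! j)) dvd card (pverts C)"
  obtains p' where "hamiltonian_cycle (torus (Cs @ [C])) p'"
    and "\<And>r. run_property p r \<Longrightarrow> run_property p' r"
proof -

  \<comment> \<open>Indexing the Hamiltonian cycle and the two factors\<close>
  define n q m where "n = length p" and "q = int (card (pverts (Cs ! j)))"
    and "m = card (pverts C)"
  obtain f where n: "n > 0" and p_nth: "\<And>i. p ! (i mod n) = (f i, f (Suc i))"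
    and f_arc: "\<And>i. (f i, f (Suc i)) \<in> parcs (torus Cs)"
    and f_eq: "\<And>i k. f i = f k \<longleftrightarrow> i mod n = k mod n"
    and f_verts: "f ` {..<n} = pverts (torus Cs)"
    unfolding n_def using H by (rule hamiltonian_cycleE) blast
  obtain c where m: "m \<ge> 2" and c_eq: "\<And>a b. c a = c b \<longleftrightarrow> a mod int m = b mod int m"
    and c_verts: "range c = pverts C"
    and c_arc: "\<And>u v. (u, v) \<in> parcs C \<longleftrightarrow> (\<exists>a. \<exists>e\<in>{1, -1}. u = c a \<and> v = c (a + e))"
    unfolding m_def using C by (rule undirected_cycleE) blast
  obtain d where d_eq: "\<And>a b. d a = d b \<longleftrightarrow> a mod q = b mod q"
    and d_verts: "range d = pverts (Cs ! j)"
    and d_arc: "\<And>u v. (u, v) \<in> parcs (Cs ! j) \<longleftrightarrow>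
      (\<exists>a. \<exists>e\<in>{1, -1}. u = d a \<and> v = d (a + e))"
    unfolding q_def using Cj by (rule undirected_cycleE) blast
  have q_dvd: "q dvd int m" using dvd by (simp add: q_def m_def)
  \<comment> \<open>Neighbours differ because \<open>m\<close> is at least 2. This lets
    \<open>arc_dim\<close> recognise a step in the new dimension.\<close>
  have c_neq: "c a \<noteq> c (a + e)" if "e \<in> {1, -1}" for a e
  proof
    assume "c a = c (a + e)"
    then have "int m dvd e" by (auto simp: c_eq mod_eq_dvd_iff)
    then have "int m dvd 1" using that by auto
    with m show False by simp
  qed

  \<comment> \<open>Rotating the cycle so that each lap ends in dimension j\<close>
  obtain t where t: "f t ! j \<noteq> f (Suc t) ! j"
  proof -
    have "pverts (torus Cs) \<noteq> {}" using n f_verts by auto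
    from hamiltonian_cycle_uses_dim[of Cs j f "{..<n}", OF Cj j f_verts this]
    obtain a b where "f a ! j \<noteq> f b ! j" by metis
    \<comment> \<open>If no arc changed coordinate \<open>j\<close>, it would be constant along the
      cycle.\<close>
    moreover have "f a ! j = f 0 ! j" if "\<And>t. f t ! j = f (Suc t) ! j" for a
      using that by (induction a) auto
    ultimately show thesis using that by metis
  qed
  \<comment> \<open>The cycle is rotated so that its arc at position \<open>n - 1\<close> lies in dimension \<open>j\<close>.\<close>
  define g where "g i = f (i + Suc t)" for i
  have g_arc: "(g i, g (Suc i)) \<in> parcs (torus Cs)" for i
    using f_arc[of "i + Suc t"] by (simp add: g_def)
  have g_verts: "g i \<in> pverts (torus Cs)" for i
    using g_arc[of i] by (simp add: in_parcs_torus)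
  have g_len: "length (g i) = length Cs" for i
    using g_verts[of i] by (simp add: in_pverts_torus)
  have mod_eq: "x mod n = y mod n \<longleftrightarrow> int n dvd int x - int y" for x y
    unfolding mod_eq_dvd_iff[symmetric] by (simp flip: of_nat_mod)
  have g_eq: "g i = g k \<longleftrightarrow> i mod n = k mod n" for i k
    unfolding g_def f_eq mod_eq by simp
  have g_range: "\<exists>i<n. g i = xs" if xs: "xs \<in> pverts (torus Cs)" for xs
  proof -
    obtain k where "f k = xs" using xs unfolding f_verts[symmetric] by blast
    \<comment> \<open>Adding the multiple \<open>n * Suc t\<close> of the period keeps the natural
      subtraction from truncating.\<close>
    define i where "i = k + n * Suc t - Suc t"
    have "Suc t \<le> n * Suc t" using n by (cases n) simp_all
    then have "i + Suc t = k + n * Suc t" by (simp add: i_def)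
    then have "f (i + Suc t) = f k" by (simp only: f_eq mod_mult_self2)
    then have "g (i mod n) = xs" using \<open>f k = xs\<close> g_eq[of "i mod n" i] by (simp add: g_def)
    moreover have "i mod n < n" using n by simp
    ultimately show ?thesis by blast
  qed
  have g_dim: "arc_dim (g s, g (Suc s)) = i"
    if "i < length Cs" "g s ! i \<noteq> g (Suc s) ! i" for i s
  proof -
    from g_arc[of s] obtain k where "k < length Cs"
      "\<forall>l<length Cs. l \<noteq> k \<longrightarrow> g s ! l = g (Suc s) ! l"
      by (auto simp: in_parcs_torus)
    with that show ?thesis by (intro arc_dim_eq) (auto simp: g_len)
  qed

  \<comment> \<open>The positions with \<open>Suc s mod n = 0\<close> are those where
    \<open>s div n\<close> increases; by the rotation they carry the chosen arc.\<close>
  have last_neq: "g s ! j \<noteq> g (Suc s) ! j" if "Suc s mod n = 0" for s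
  proof -
    have "f (Suc s + t) = f (0 + t)" "f (Suc s + Suc t) = f (0 + Suc t)"
      unfolding f_eq using that by (metis mod_add_left_eq mod_0)+
    with t show ?thesis by (simp add: g_def)
  qed
  \<comment> \<open>If coordinate \<open>l\<close> changed as well, \<open>g_dim\<close> would make
    \<open>arc_dim\<close> equal to both \<open>l\<close> and \<open>j\<close>.\<close>
  have last_other: "g s ! l = g (Suc s) ! l" if "Suc s mod n = 0" "l < length Cs" "l \<noteq> j" for s l
    using g_dim[of l s] g_dim[of j s] last_neq[OF that(1)] that j by auto
  \<comment> \<open>\<open>e\<close> is the direction of the chosen arc along \<open>Cs ! j\<close>.
    By periodicity one pair \<open>b\<close>, \<open>e\<close> serves all laps, and the new
    coordinate will move by the same \<open>e\<close>.\<close>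
  obtain b e where e: "e \<in> {1, -1}"
    and be: "\<And>s. Suc s mod n = 0 \<Longrightarrow> g s ! j = d b \<and> g (Suc s) ! j = d (b + e)"
  proof -
    have "Suc (n - 1) mod n = 0" using n by simp
    from last_neq[OF this] g_arc[of "n - 1"] obtain k where k: "k < length Cs"
      "(g (n - 1) ! k, g (Suc (n - 1)) ! k) \<in> parcs (Cs ! k)"
      "\<forall>l<length Cs. l \<noteq> k \<longrightarrow> g (n - 1) ! l = g (Suc (n - 1)) ! l"
      unfolding in_parcs_torus by blast
    then have "k = j" using j last_neq[OF \<open>Suc (n - 1) mod n = 0\<close>] by blast
    from k(2)[unfolded this d_arc] obtain b e
      where "e \<in> {1, -1}" "g (n - 1) ! j = d b" "g (Suc (n - 1)) ! j = d (b + e)"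
      by blast
    note be = this
    have s: "g s = g (n - 1)" "g (Suc s) = g (Suc (n - 1))" if "Suc s mod n = 0" for s
      using that n by (auto simp: g_eq mod_Suc split: if_splits)
    show thesis using be(2,3) by (intro that[of e b] be(1)) (simp add: s)
  qed

  \<comment> \<open>Translations of the j-th cycle\<close>
  define idx where "idx x = (SOME a. d a = x)" for x
  \<comment> \<open>The sign is chosen so that coordinates \<open>sh a x\<close> and
    \<open>a\<close> add up to \<open>x\<close>. The representative picked by \<open>idx\<close>
    does not matter, since \<open>d\<close> has period \<open>q\<close>.\<close>
  define sh where "sh a x = d (idx x - a)" for a x
  have sh_d: "sh a (d b) = d (b - a)" for a b
  proof -
    have "d (idx (d b)) = d b" unfolding idx_def by (rule someI) (rule refl)
    then show ?thesis unfolding sh_def d_eq by (rule mod_diff_cong) (rule refl)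
  qed
  have sh_verts: "sh a x \<in> pverts (Cs ! j)" for a x
    unfolding sh_def by (simp flip: d_verts)
  have sh_sh: "sh a (sh b x) = sh (a + b) x" if "x \<in> pverts (Cs ! j)" for a b x
    using that by (auto simp flip: d_verts simp: sh_d algebra_simps)
  have sh_dvd: "sh a x = x" if "x \<in> pverts (Cs ! j)" "q dvd a" for a x
    using that by (auto simp flip: d_verts simp: sh_d d_eq mod_eq_dvd_iff)
  have sh_inj: "sh a x = sh a y \<longleftrightarrow> x = y"
    if "x \<in> pverts (Cs ! j)" "y \<in> pverts (Cs ! j)" for a x y
    using that by (auto simp flip: d_verts simp: sh_d d_eq mod_eq_dvd_iff)
  have sh_arc: "(sh a x, sh a y) \<in> parcs (Cs ! j)" if "(x, y) \<in> parcs (Cs ! j)" for a x y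
    using that unfolding d_arc
    by (auto simp: sh_d algebra_simps)

  \<comment> \<open>The lifted vertex sequence\<close>
  define a where "a s = e * int (s div n)" for s
  \<comment> \<open>On lap \<open>s div n\<close> the new coordinate has index \<open>a s\<close>;
    shifting coordinate \<open>j\<close> back by the same amount puts \<open>h s\<close> over
    \<open>g s\<close> under the projection.\<close>
  define base where "base s = (g s)[j := sh (a s) (g s ! j)]" for s
  define h where "h s = base s @ [c (a s)]" for s
  have gj: "g s ! j \<in> pverts (Cs ! j)" for s
    using g_verts[of s] j by (simp add: in_pverts_torus)
  have base_verts: "base s \<in> pverts (torus Cs)" for s
    using g_verts[of s] j sh_verts by (auto simp: base_def in_pverts_torus nth_list_update)
  have base_len: "length (base s) = length Cs" for s by (simp add: base_def g_len)
  have ca: "c x \<in> pverts C" for x by (simp flip: c_verts)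
  have h_verts: "h s \<in> pverts (torus (Cs @ [C]))" for s
    by (simp add: h_def snoc_in_pverts_torus base_verts ca)

  have a_same: "a (Suc s) = a s" if "Suc s mod n \<noteq> 0" for s
    using that by (simp add: a_def div_Suc)
  have a_last: "a (Suc s) = a s + e" if "Suc s mod n = 0" for s
    using that by (simp add: a_def div_Suc algebra_simps)
  \<comment> \<open>Coordinate \<open>j\<close> of \<open>g\<close> advances by \<open>e\<close> and
    the backward shift also grows by \<open>e\<close>. The two cancel, so that only the new
    coordinate moves.\<close>
  have base_last: "base (Suc s) = base s" if "Suc s mod n = 0" for s
  proof (rule nth_equalityI)
    fix i assume "i < length (base (Suc s))"
    then show "base (Suc s) ! i = base s ! i"
      using j last_other[OF that, of i] be[OF that]
      by (cases "i = j") (auto simp: base_def g_len a_last[OF that] sh_d algebra_simps)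
  qed (simp add: base_len)

  \<comment> \<open>The second conjunct is what transfers runs: renaming the new dimension to
    \<open>j\<close> recovers the dimension of the arc below.\<close>
  have h_step: "(h s, h (Suc s)) \<in> parcs (torus (Cs @ [C])) \<and> arc_dim (g s, g (Suc s)) =
    (if arc_dim (h s, h (Suc s)) = length Cs then j else arc_dim (h s, h (Suc s)))" for s
  proof (cases "Suc s mod n = 0")
    case True
    have "(c (a s), c (a s + e)) \<in> parcs C" using e by (auto simp: c_arc)
    then have "(h s, h (Suc s)) \<in> parcs (torus (Cs @ [C]))"
      unfolding h_def base_last[OF True] a_last[OF True]
      by (intro snoc_in_parcs_torus_last base_verts ca)
    moreover have "arc_dim (h s, h (Suc s)) = length Cs"
      unfolding h_def base_last[OF True] a_last[OF True] using c_neq[OF e]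
      by (intro arc_dim_eq) (auto simp: base_len nth_append)
    moreover have "arc_dim (g s, g (Suc s)) = j" using g_dim j last_neq[OF True] by blast
    ultimately show ?thesis by simp
  next
    case False
    from g_arc[of s] obtain k where k: "k < length Cs"
      "(g s ! k, g (Suc s) ! k) \<in> parcs (Cs ! k)"
      "\<And>l. l < length Cs \<Longrightarrow> l \<noteq> k \<Longrightarrow> g s ! l = g (Suc s) ! l"
      by (auto simp: in_parcs_torus)
    \<comment> \<open>Within a lap the shift is constant, and a translation of \<open>Cs ! j\<close>
      preserves its arcs.\<close>
    have base_k: "(base s ! k, base (Suc s) ! k) \<in> parcs (Cs ! k)"
      using k(1,2) sh_arc[of "g s ! j" "g (Suc s) ! j"]
      by (cases "k = j") (simp_all add: base_def a_same[OF False] g_len)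
    have base_l: "base s ! l = base (Suc s) ! l" if "l < length Cs" "l \<noteq> k" for l
      using k(3)[OF that] that(1) by (cases "l = j") (simp_all add: base_def a_same[OF False] g_len)
    have "(base s, base (Suc s)) \<in> parcs (torus Cs)"
      unfolding in_parcs_torus using base_verts base_k base_l k(1) by blast
    then have "(h s, h (Suc s)) \<in> parcs (torus (Cs @ [C]))"
      unfolding h_def a_same[OF False] by (intro snoc_in_parcs_torus ca)
    moreover interpret pair_graph "Cs ! k" by (rule loopfree[OF k(1)])
    have "arc_dim (h s, h (Suc s)) = k"
      unfolding h_def a_same[OF False] using pair_no_loops[OF base_k] k(1) base_l
      by (intro arc_dim_eq) (auto simp: base_len nth_append)
    moreover have "arc_dim (g s, g (Suc s)) = k"
      using g_dim[OF k(1)] pair_no_loops[OF k(2)] by simp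
    ultimately show ?thesis using k(1) by simp
  qed

  \<comment> \<open>The lift visits every vertex exactly once\<close>
  have h_inj: "inj_on h {..<n * m}"
  proof (rule inj_onI)
    fix x y assume "x \<in> {..<n * m}" "y \<in> {..<n * m}" and xy: "h x = h y"
    \<comment> \<open>The last coordinate determines the lap number modulo \<open>m\<close>, as
      \<open>e\<close> is a unit, and both lap numbers are below \<open>m\<close>. With equal laps
      the shift can be undone, which leaves the position within the lap.\<close>
    then have lt: "x div n < m" "y div n < m" by (auto simp: less_mult_imp_div_less mult.commute)
    from xy have base: "base x = base y" and "c (a x) = c (a y)" by (auto simp: h_def)
    then have "int m dvd e * (int (x div n) - int (y div n))"
      by (simp add: c_eq a_def mod_eq_dvd_iff algebra_simps)
    then have "int m dvd int (x div n) - int (y div n)"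
      using e by (auto simp: dvd_diff_commute)
    then have "int (x div n) mod int m = int (y div n) mod int m" by (simp add: mod_eq_dvd_iff)
    then have div: "x div n = y div n" using lt by simp
    then have "a x = a y" by (simp add: a_def)
    have "g x ! i = g y ! i" if "i < length Cs" for i
    proof (cases "i = j")
      case True
      have "base x ! j = base y ! j" by (simp add: base)
      then show ?thesis using True j gj sh_inj by (simp add: base_def g_len \<open>a x = a y\<close>)
    next
      case False
      have "base x ! i = base y ! i" by (simp add: base)
      then show ?thesis using False by (simp add: base_def)
    qed
    then have "g x = g y" by (intro nth_equalityI) (auto simp: g_len)
    then have "x mod n = y mod n" by (simp add: g_eq)
    with div show "x = y" by (metis div_mult_mod_eq)
  qed
  have h_surj: "h ` {..<n * m} = pverts (torus (Cs @ [C]))"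
  proof
    show "pverts (torus (Cs @ [C])) \<subseteq> h ` {..<n * m}"
    proof
      fix ys assume ys: "ys \<in> pverts (torus (Cs @ [C]))"
      then obtain xs y where [simp]: "ys = xs @ [y]"
        by (cases ys rule: rev_cases) (auto simp: in_pverts_torus)
      with ys have xs: "xs \<in> pverts (torus Cs)" and "y \<in> range c"
        by (auto simp: snoc_in_pverts_torus c_verts)
      then obtain z where z: "y = c z" by blast
      \<comment> \<open>The lap on which the last coordinate is \<open>c z\<close>: it must satisfy
        \<open>e * k = z\<close> modulo \<open>m\<close>, and \<open>e * e = 1\<close>.\<close>
      define k where "k = nat ((e * z) mod int m)"
      have k: "k < m" using m by (simp add: k_def nat_less_iff)
      have "e * int k mod int m = e * (e * z) mod int m"
        using m by (simp add: k_def mod_mult_right_eq)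
      then have y: "y = c (e * int k)" using e by (auto simp: z c_eq)
      have xj: "xs ! j \<in> pverts (Cs ! j)" and len: "length xs = length Cs"
        using xs j by (auto simp: in_pverts_torus)
      \<comment> \<open>This undoes the shift applied on lap \<open>k\<close>; the position of the
        resulting vertex in \<open>g\<close> is the position to take within that lap.\<close>
      have "xs[j := sh (- (e * int k)) (xs ! j)] \<in> pverts (torus Cs)"
        using xs j sh_verts by (auto simp: in_pverts_torus nth_list_update)
      then obtain i where i: "i < n" "g i = xs[j := sh (- (e * int k)) (xs ! j)]"
        using g_range by blast
      let ?s = "n * k + i"
      have "?s div n = k" "g ?s = g i" using i(1) by (simp_all add: g_eq)
      then have "h ?s = ys" using j xj len
        by (simp add: h_def base_def a_def i(2) y sh_sh sh_dvd)
      moreover have "?s < n * m"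
      proof -
        have "n * k + i < n * Suc k" using i(1) by simp
        also have "\<dots> \<le> n * m" using k by (intro mult_left_mono) auto
        finally show ?thesis .
      qed
      ultimately show "ys \<in> h ` {..<n * m}" by blast
    qed
  qed (use h_verts in auto)
  \<comment> \<open>Here divisibility enters: after \<open>m\<close> laps coordinate
    \<open>j\<close> has been shifted by \<open>e * m\<close>, a multiple of
    \<open>q\<close>.\<close>
  have h_closed: "h (n * m) = h 0"
  proof -
    have "base (n * m) = base 0"
      using n sh_dvd[OF gj] q_dvd g_eq[of "n * m" 0]
      by (simp add: base_def a_def)
    moreover have "c (a (n * m)) = c (a 0)" using n by (simp add: a_def c_eq)
    ultimately show ?thesis by (simp add: h_def)
  qed

  \<comment> \<open>Runs of the lifted cycle\<close>
  define p' where "p' = map (\<lambda>i. (h i, h (Suc i))) [0..<n * m]"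
  have "hamiltonian_cycle (torus (Cs @ [C])) p'"
    unfolding p'_def using n m h_closed h_inj h_surj h_step by (intro hamiltonian_cycleI) auto
  moreover have "run_property p' r" if r: "run_property p r" for r
    unfolding run_property_iff_inj_on
  proof
    fix s
    let ?\<phi> = "\<lambda>i. if i = length Cs then j else i"
    have len: "length p' = n * m" by (simp add: p'_def)
    \<comment> \<open>The window of \<open>p'\<close> at \<open>s\<close> lies over the window of
      \<open>p\<close> at \<open>s + Suc t\<close>, where \<open>Suc t\<close> is the offset of the
      rotation.\<close>
    have "arc_dim (p ! ((s + Suc t + i) mod n)) = ?\<phi> (arc_dim (p' ! ((s + i) mod (n * m))))" for i
    proof -
      let ?u = "(s + i) mod (n * m)"
      have "?u < n * m" using n m by simp
      then have "p' ! ?u = (h ?u, h (Suc ?u))" by (simp add: p'_def)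
      then have "?\<phi> (arc_dim (p' ! ?u)) = arc_dim (g ?u, g (Suc ?u))" using h_step[of ?u] by simp
      moreover have "g ?u = g (s + i)" "g (Suc ?u) = g (Suc (s + i))"
        by (simp_all add: g_eq mod_Suc mod_mod_cancel)
      moreover have "p ! ((s + Suc t + i) mod n) = (g (s + i), g (Suc (s + i)))"
        using p_nth[of "s + Suc t + i"] by (simp add: g_def ac_simps)
      ultimately show ?thesis by simp
    qed
    moreover have "inj_on (\<lambda>i. arc_dim (p ! ((s + Suc t + i) mod n))) {..<r}"
      using r unfolding run_property_iff_inj_on n_def by blast
    ultimately have "inj_on (?\<phi> \<circ> (\<lambda>i. arc_dim (p' ! ((s + i) mod (n * m))))) {..<r}"
      by (simp add: comp_def)
    \<comment> \<open>If a composite is injective, then so is its inner map; \<open>?\<phi>\<close>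
      itself identifies two dimensions.\<close>
    then show "inj_on (\<lambda>i. arc_dim (p' ! ((s + i) mod length p'))) {..<r}"
      unfolding len by (rule inj_on_imageI2)
  qed
  ultimately show thesis using that by blast
qed

text \<open>The conclusion includes \<open>hamiltonian\<close> so that the \<open>Max\<close> in the
  larger \<open>max_run_length\<close> is over a nonempty set and hence a true maximum.\<close>

theorem theorem5:
  fixes \<gamma>s :: "'a pair_pre_digraph list" and \<gamma> :: "'a pair_pre_digraph" and j :: nat
  assumes "\<forall>C \<in> set \<gamma>s. undirected_cycle C"
    and "hamiltonian (torus \<gamma>s)"
    and "undirected_cycle \<gamma>"
    and "j < length \<gamma>s"
    and "card (pverts (\<gamma>s ! j)) dvd card (pverts \<gamma>)"
  shows "hamiltonian (torus (\<gamma>s @ [\<gamma>])) \<and>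
         max_run_length (\<gamma>s @ [\<gamma>]) \<ge> max_run_length \<gamma>s"
proof -
  from assms(2) have "{run_length p | p. hamiltonian_cycle (torus \<gamma>s) p} \<noteq> {}"
    by (auto simp: hamiltonian_def)
  from Max_in[OF finite_run_lengths this] obtain p
    where p: "hamiltonian_cycle (torus \<gamma>s) p" and max: "max_run_length \<gamma>s = run_length p"
    by (auto simp: max_run_length_def)
  have "undirected_cycle (\<gamma>s ! i)" if "i < length \<gamma>s" for i
    using assms(1) that by simp
  with p assms(3-5) obtain p' where p': "hamiltonian_cycle (torus (\<gamma>s @ [\<gamma>])) p'"
    and run: "\<And>r. run_property p r \<Longrightarrow> run_property p' r"
    by (rule_tac lift_hamiltonian_cycle) (auto simp: undirected_cycle_def)
  have "run_length p \<le> run_length p'"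
    using p p' by (intro run_length_ge run run_property_run_length hamiltonian_cycle_not_Nil)
  also have "\<dots> \<le> max_run_length (\<gamma>s @ [\<gamma>])"
    unfolding max_run_length_def using p' by (intro Max_ge finite_run_lengths) blast
  finally show ?thesis using p' max by (auto simp: hamiltonian_def)
qed

end
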